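(* For any integer $n\geq 2$, the involutory Cayley graph $\mathcal{G}(\mathbb{Z}_n[x])$ of $\mathbb{Z}_n[x]$ is disconnected.
   Context: $\mathbb{Z}_n$ denotes the ring of integers modulo $n$. For a commutative ring $R$ with identity, the involutory Cayley graph $\mathcal{G}(R)$ is the simple undirected graph with vertex set $R$ in which two vertices $a,b$ are adjacent if and only if $(a-b)^2=1$. *)

theory Defs
  imports
    "HOL-Algebra.UnivPoly"
    "HOL-Number_Theory.Residues"
    "Graph_Theory.Graph_Theory"
begin

text \<open>
  An undirected graph is represented by its symmetric digraph, each edge being a pair of
  opposite arcs. The condition \<open>a \<noteq> b\<close> only matters for the zero ring, where
  \<open>(a - a)\<^sup>2 = 1\<close> would otherwise give a loop.
\<close>

definition involutory_Cayley_graph :: "('a, 'm) ring_scheme \<Rightarrow> 'a pair_pre_digraph" where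
  "involutory_Cayley_graph R =
     \<lparr> pverts = carrier R,
       parcs = {(a, b). a \<in> carrier R \<and> b \<in> carrier R \<and> a \<noteq> b \<and>
                        (a \<ominus>\<^bsub>R\<^esub> b) [^]\<^bsub>R\<^esub> (2::nat) = \<one>\<^bsub>R\<^esub>} \<rparr>"

lemma (in cring) involutory_Cayley_graph_bidirected:
  "pair_bidirected_digraph (involutory_Cayley_graph R)"
proof -
  have sq: "(b \<ominus> a) [^] (2::nat) = (a \<ominus> b) [^] (2::nat)"
    if "a \<in> carrier R" "b \<in> carrier R" for a b
  proof -
    have "b \<ominus> a = \<ominus> (a \<ominus> b)"
      using that by (simp add: minus_eq minus_add a_comm)
    then show ?thesis
      using that by (simp add: numeral_2_eq_2 l_minus r_minus)
  qed
  show ?thesis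
    by unfold_locales (auto simp: involutory_Cayley_graph_def symmetric_def arcs_ends_conv sq intro!: symI)
qed

end

theory Submission
  imports Defs
begin

text \<open>
  Let \<open>I\<close> be a prime ideal of \<open>R\<close>. The ring \<open>(R/I)[x]\<close> is a domain, so its only square roots of
  unity are the constants \<open>\<plusminus>1\<close>; hence every \<open>f \<in> R[x]\<close> with \<open>f\<^sup>2 = 1\<close> is constant modulo \<open>I\<close>.
  Adjacent vertices of \<open>\<G>(R[x])\<close> differ by such an \<open>f\<close>, so the class in \<open>R/I\<close> of the linear
  coefficient does not change along a walk. It is \<open>0\<close> at the vertex \<open>0\<close> and \<open>1 \<noteq> 0\<close> at the vertex
  \<open>x\<close>, and no walk joins these two. For \<open>R = \<int>\<^sub>n\<close> with \<open>n \<ge> 2\<close> the multiples of a prime divisor of \<open>n\<close>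
  form such an ideal.

  Reduction modulo \<open>I\<close> is necessary: \<open>1 + 2x\<close> is a square root of unity over \<open>\<int>\<^sub>4\<close>. It is done
  on coefficients, without forming the quotient ring: if \<open>m > 0\<close> is the largest index of a
  coefficient outside \<open>I\<close>, then \<open>f\<^sup>2\<close> has a coefficient outside \<open>I\<close> at \<open>2m > 0\<close>
  (\<open>coeff_in_prime_ideal_if_square_coeffs\<close>). The walk argument for an arbitrary prime ideal is
  \<open>not_connected_involutory_Cayley_graph\<close>, and \<open>primeideal_multiples_of_prime\<close> supplies the ideal.
\<close>

lemma (in ideal) finsum_in_ideal:
  assumes "\<And>x. x \<in> A \<Longrightarrow> f x \<in> I"
  shows "finsum R f A \<in> I"
  using assms
proof (induction A rule: infinite_finite_induct)
  case (insert a A)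
  then have "f \<in> A \<rightarrow> carrier R" "f a \<in> carrier R"
    using a_subset by auto
  with insert show ?case
    by (simp add: finsum_insert additive_subgroup.a_closed[OF is_additive_subgroup])
qed (simp_all add: finsum_infinite)

text \<open>
  Modulo \<open>I\<close> the highest term \<open>c x\<^sup>m\<close> of \<open>f\<close> squares to the highest term \<open>c\<^sup>2 x\<^bsup>2m\<^esup>\<close> of \<open>f\<^sup>2\<close>,
  and primality of \<open>I\<close> keeps \<open>c\<^sup>2\<close> outside \<open>I\<close>.
\<close>

lemma (in UP_cring) coeff_in_prime_ideal_if_square_coeffs:
  assumes prime: "primeideal I R"
    and f: "f \<in> carrier P"
    and square: "\<And>k. k > 0 \<Longrightarrow> coeff P (f \<otimes>\<^bsub>P\<^esub> f) k \<in> I"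
    and "i > 0"
  shows "coeff P f i \<in> I"
proof (rule ccontr)
  interpret I: primeideal I R by (rule prime)
  let ?c = "coeff P f"
  define S where "S = {i. i > 0 \<and> ?c i \<notin> I}"
  assume "?c i \<notin> I"
  with \<open>i > 0\<close> have "i \<in> S" by (simp add: S_def)
  have "S \<subseteq> {..deg R f}"
  proof
    fix j assume "j \<in> S"
    then have "?c j \<noteq> \<zero>" by (auto simp: S_def)
    then show "j \<in> {..deg R f}" using deg_aboveD[OF _ f] by (meson atMost_iff not_le)
  qed
  then have fin: "finite S" by (rule finite_subset) simp
  define m where "m = Max S"
  have "m \<in> S" using Max_in[OF fin] \<open>i \<in> S\<close> by (auto simp: m_def)
  then have "m > 0" and m: "?c m \<notin> I" by (auto simp: S_def)
  have above: "?c j \<in> I" if "j > m" for j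
    using that Max_ge[OF fin, of j] by (auto simp: m_def S_def)
  have c: "?c j \<in> carrier R" for j using f by simp
  \<comment> \<open>In the coefficient of \<open>f\<^sup>2\<close> at \<open>2m\<close> every product other than the middle one has a factor
    with index above \<open>m\<close>.\<close>
  let ?t = "\<lambda>j. ?c j \<otimes> ?c (2 * m - j)"
  let ?s = "finsum R ?t ({..2 * m} - {m})"
  have s: "?s \<in> I"
  proof (rule I.finsum_in_ideal)
    fix j assume "j \<in> {..2 * m} - {m}"
    then consider "j > m" | "2 * m - j > m" by force
    then show "?t j \<in> I"
      by cases (use above c in \<open>blast intro: I.I_l_closed I.I_r_closed\<close>)+
  qed
  have "coeff P (f \<otimes>\<^bsub>P\<^esub> f) (2 * m) = finsum R ?t (insert m ({..2 * m} - {m}))"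
    using f by (simp add: insert_absorb)
  also have "\<dots> = ?c m \<otimes> ?c m \<oplus> ?s"
    using c by (subst R.finsum_insert) (auto simp: mult_2)
  finally have sum: "?c m \<otimes> ?c m \<oplus> ?s \<in> I"
    using square[of "2 * m"] \<open>m > 0\<close> by simp
  have "?s \<in> carrier R" using s I.a_subset by blast
  then have "?c m \<otimes> ?c m = (?c m \<otimes> ?c m \<oplus> ?s) \<ominus> ?s"
    using c by (simp add: R.minus_eq R.a_assoc R.r_neg)
  also have "\<dots> \<in> I"
    using sum s by (simp add: R.minus_eq I.a_closed I.a_inv_closed)
  finally show False using I.I_prime c m by blast
qed

text \<open>
  Connectedness of a digraph is defined through its symmetric closure. The arcs here already come
  in opposite pairs, so the closure adds none.
\<close>

lemma (in cring) arcs_ends_mk_symmetric_involutory_Cayley_graph: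
  "arcs_ends (with_proj (mk_symmetric (with_proj (involutory_Cayley_graph R)))) =
     parcs (involutory_Cayley_graph R)"
proof -
  interpret pair_bidirected_digraph "involutory_Cayley_graph R"
    by (rule involutory_Cayley_graph_bidirected)
  show ?thesis using adj_mk_symmetric_eq[OF sym_arcs] by (simp add: arcs_ends_conv)
qed

text \<open>
  Each step of a walk subtracts a polynomial whose linear coefficient lies in \<open>I\<close>, so a walk from
  \<open>0\<close> never leaves the polynomials with linear coefficient in \<open>I\<close>, while \<open>x\<close> is not among them.
\<close>

lemma (in UP_cring) not_connected_involutory_Cayley_graph:
  assumes prime: "primeideal I R"
  shows "\<not> Digraph_Component.connected (involutory_Cayley_graph P)"
proof
  interpret I: primeideal I R by (rule prime)
  let ?G = "with_proj (mk_symmetric (with_proj (involutory_Cayley_graph P)))"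
  let ?X = "monom P \<one> 1"
  assume "Digraph_Component.connected (involutory_Cayley_graph P)"
  then have "\<zero>\<^bsub>P\<^esub> \<rightarrow>\<^sup>*\<^bsub>?G\<^esub> ?X"
    by (auto simp: Digraph_Component.connected_def strongly_connected_def involutory_Cayley_graph_def)
  then have "(\<zero>\<^bsub>P\<^esub>, ?X) \<in> (parcs (involutory_Cayley_graph P))\<^sup>*"
    unfolding P.arcs_ends_mk_symmetric_involutory_Cayley_graph[symmetric]
    by (rule reachable_rtranclI)
  then have "coeff P ?X 1 \<in> I"
  proof (induction rule: rtrancl_induct)
    case base
    show ?case by simp
  next
    case (step a b)
    then have a: "a \<in> carrier P" and b: "b \<in> carrier P"
      and sq: "(a \<ominus>\<^bsub>P\<^esub> b) [^]\<^bsub>P\<^esub> (2::nat) = \<one>\<^bsub>P\<^esub>"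
      by (auto simp: involutory_Cayley_graph_def)
    from a b have ab: "a \<ominus>\<^bsub>P\<^esub> b \<in> carrier P" by simp
    with sq have "(a \<ominus>\<^bsub>P\<^esub> b) \<otimes>\<^bsub>P\<^esub> (a \<ominus>\<^bsub>P\<^esub> b) = \<one>\<^bsub>P\<^esub>"
      by (simp add: numeral_2_eq_2)
    then have "coeff P (a \<ominus>\<^bsub>P\<^esub> b) 1 \<in> I"
      by (intro coeff_in_prime_ideal_if_square_coeffs[OF prime ab])
        (simp_all del: coeff_mult)
    then have d: "coeff P a 1 \<ominus> coeff P b 1 \<in> I"
      using a b by simp
    have "coeff P b 1 = coeff P a 1 \<ominus> (coeff P a 1 \<ominus> coeff P b 1)"
      using a b by (simp add: R.minus_eq R.minus_add R.a_assoc[symmetric] R.r_neg)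
    also have "\<dots> \<in> I"
      using d step.IH by (simp add: R.minus_eq I.a_closed I.a_inv_closed)
    finally show ?case .
  qed
  then have "\<one> \<in> I" by simp
  then show False using I.one_imp_carrier I.I_notcarr by simp
qed

text \<open>
  Reducing modulo \<open>m\<close> does not affect divisibility by a divisor \<open>p\<close> of \<open>m\<close>, so the operations of the
  residue ring treat the multiples of \<open>p\<close> as those of \<open>\<int>\<close> do.
\<close>

lemma (in residues) primeideal_multiples_of_prime:
  fixes p :: int
  assumes p: "prime p" and dvd: "p dvd m"
  shows "primeideal {k \<in> carrier R. p dvd k} R"
proof (rule primeidealI2)
  have red: "p dvd k mod m \<longleftrightarrow> p dvd k" for k
    using dvd by (rule dvd_mod_iff)
  let ?I = "{k \<in> carrier R. p dvd k}"
  show "additive_subgroup ?I R"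
  proof (intro additive_subgroupI add.subgroupI)
    show "?I \<noteq> {}" using zero_closed by (force simp: res_zero_eq)
    show "\<ominus> a \<in> ?I" if "a \<in> ?I" for a
      using that a_inv_closed[of a] by (simp add: res_neg_eq red)
    show "a \<oplus> b \<in> ?I" if "a \<in> ?I" "b \<in> ?I" for a b
      using that a_closed[of a b] by (simp add: res_add_eq red)
  qed auto
  show "x \<otimes> a \<in> ?I" "a \<otimes> x \<in> ?I" if "a \<in> ?I" "x \<in> carrier R" for a x
    using that m_closed[of x a] m_closed[of a x] by (simp_all add: res_mult_eq red)
  have "\<one> \<notin> ?I"
    using p not_prime_unit[of p] by (auto simp: res_one_eq)
  then show "carrier R \<noteq> ?I" using one_closed by blast
  show "a \<in> ?I \<or> b \<in> ?I"
    if "a \<in> carrier R" "b \<in> carrier R" "a \<otimes> b \<in> ?I" for a b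
    using that p by (simp add: res_mult_eq red prime_dvd_mult_iff)
qed (rule cring)

theorem corollary3p2:
  fixes n :: int
  assumes "n \<ge> 2"
  shows "\<not> Digraph_Component.connected (involutory_Cayley_graph (UP (residue_ring n)))"
proof -
  interpret residues n "residue_ring n"
    using assms by unfold_locales simp_all
  interpret UP_cring "residue_ring n" "UP (residue_ring n)"
    by (intro UP_cring.intro cring)
  obtain p where "prime p" "p dvd n"
    using prime_divisor_exists[of n] assms by auto
  then show ?thesis
    by (rule not_connected_involutory_Cayley_graph[OF primeideal_multiples_of_prime])
qed

end
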